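(* For every integer $k \geq 1$ and all real constants $c_1, c_2 > 0$, there exists a constant $d > 0$ depending only on $k$, $c_1$ and $c_2$ such that for all integers $t \geq 2$ and $m$ with $c_1 \log^2 t \leq m \leq c_2 2^t$, $$r_k(K_{2,t};K_m) \geq d\,\frac{m^2 t}{\log^2(mt)}.$$
   Context: For graphs $H, G$ and an integer $k\ge 1$, the Ramsey number $r_k(H;G)$ is the minimum integer $r$ such that in every edge-coloring of the complete graph $K_r$ with $k+1$ colors, there is a monochromatic copy of $H$ in one of the first $k$ colors or a copy of $G$ in the $(k+1)$-st color (copies are not necessarily induced subgraphs). $K_{2,t}$ is the complete bipartite graph with parts of sizes $2$ and $t$; $K_m$ is the complete graph on $m$ vertices. Logarithms are natural, and $\log^2 x$ means $(\log x)^2$. *)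

theory Defs
  imports Complex_Main "HOL-Library.Ramsey"
begin

record 'a graph =
  verts :: "'a set"
  edges :: "'a set set"

definition simple_graph :: "'a graph \<Rightarrow> bool" where
  "simple_graph H \<longleftrightarrow> finite (verts H) \<and> edges H \<subseteq> nsets (verts H) 2"

definition complete_graph :: "nat \<Rightarrow> nat graph" where
  "complete_graph n = \<lparr>verts = {..<n}, edges = nsets {..<n} 2\<rparr>"

definition complete_bipartite_graph :: "nat \<Rightarrow> nat \<Rightarrow> (nat + nat) graph" where
  "complete_bipartite_graph s t =
     \<lparr>verts = {..<s} <+> {..<t}, edges = {{Inl i, Inr j} | i j. i < s \<and> j < t}\<rparr>"

text \<open>A copy is a not necessarily induced subgraph, hence only edges are preserved.\<close>

definition contains_copy :: "'b graph \<Rightarrow> 'a graph \<Rightarrow> bool" where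
  "contains_copy G H \<longleftrightarrow>
     (\<exists>\<phi>. inj_on \<phi> (verts H) \<and> \<phi> ` verts H \<subseteq> verts G \<and> (\<forall>e\<in>edges H. \<phi> ` e \<in> edges G))"

definition colour_graph :: "'a graph \<Rightarrow> ('a set \<Rightarrow> nat) \<Rightarrow> nat \<Rightarrow> 'a graph" where
  "colour_graph G c i = \<lparr>verts = verts G, edges = {e \<in> edges G. c e = i}\<rparr>"

text \<open>The \<open>k + 1\<close> colours are \<open>0, \<dots>, k\<close>; the last one, \<open>k\<close>, is the one reserved for \<open>G\<close>.\<close>

definition ramsey_arrow :: "nat \<Rightarrow> nat \<Rightarrow> 'a graph \<Rightarrow> 'b graph \<Rightarrow> bool" where
  "ramsey_arrow r k H G \<longleftrightarrow>
     (\<forall>c \<in> edges (complete_graph r) \<rightarrow> {..k}.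
        (\<exists>i<k. contains_copy (colour_graph (complete_graph r) c i) H) \<or>
        contains_copy (colour_graph (complete_graph r) c k) G)"

definition ramsey_number :: "nat \<Rightarrow> 'a graph \<Rightarrow> 'b graph \<Rightarrow> nat" where
  "ramsey_number k H G = (LEAST r. ramsey_arrow r k H G)"

lemma simple_graph_complete: "simple_graph (complete_graph n)"
  by (simp add: simple_graph_def complete_graph_def)

lemma simple_graph_complete_bipartite: "simple_graph (complete_bipartite_graph s t)"
  by (auto simp: simple_graph_def complete_bipartite_graph_def nsets_def)

lemma contains_copy_if_clique:
  assumes H: "simple_graph H" and X: "X \<subseteq> verts G" "finite X" "card (verts H) \<le> card X"
    and clique: "nsets X 2 \<subseteq> edges G"
  shows "contains_copy G H"
proof -
  have "finite (verts H)" using H by (simp add: simple_graph_def)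
  then obtain \<phi> where \<phi>: "\<phi> ` verts H \<subseteq> X" "inj_on \<phi> (verts H)"
    using card_le_inj[of "verts H" X] X by blast
  have "\<phi> ` e \<in> edges G" if "e \<in> edges H" for e
  proof -
    have e: "e \<subseteq> verts H" "finite e" "card e = 2"
      using that H by (auto simp: simple_graph_def nsets_def)
    then have "card (\<phi> ` e) = 2"
      using \<phi>(2) by (metis card_image inj_on_subset)
    then have "\<phi> ` e \<in> nsets X 2"
      using e \<phi>(1) by (auto simp: nsets_def)
    then show ?thesis using clique by blast
  qed
  then show ?thesis using \<phi> X(1) unfolding contains_copy_def by blast
qed

text \<open>The minimum defining the Ramsey number is attained, by Ramsey's theorem.\<close>

lemma ramsey_arrow_ex:
  assumes H: "simple_graph H" and G: "simple_graph G"
  shows "\<exists>r. ramsey_arrow r k H G"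
proof -
  let ?qs = "replicate k (card (verts H)) @ [card (verts G)]"
  obtain N :: nat where N: "partn_lst {..<N} ?qs 2"
    using ramsey_full by blast
  have "(\<exists>i<k. contains_copy (colour_graph (complete_graph N) c i) H) \<or>
        contains_copy (colour_graph (complete_graph N) c k) G"
    if c: "c \<in> edges (complete_graph N) \<rightarrow> {..k}" for c
  proof -
    have "c \<in> nsets {..<N} 2 \<rightarrow> {..<Suc k}"
      using c by (simp add: complete_graph_def lessThan_Suc_atMost)
    then obtain i X where i: "i < length ?qs" and X: "X \<in> nsets {..<N} (?qs ! i)"
      and mono: "c ` nsets X 2 \<subseteq> {i}"
      using N unfolding partn_lst_def monochromatic_def by fastforce
    have sub: "X \<subseteq> {..<N}" "finite X" "card X = ?qs ! i"
      using X by (auto simp: nsets_def)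
    have "nsets X 2 \<subseteq> nsets {..<N} 2"
      using sub(1) by (rule nsets_mono)
    then have clique: "nsets X 2 \<subseteq> edges (colour_graph (complete_graph N) c i)"
      using mono by (auto simp: colour_graph_def complete_graph_def)
    have V: "X \<subseteq> verts (colour_graph (complete_graph N) c i)"
      using sub(1) by (simp add: colour_graph_def complete_graph_def)
    show ?thesis
    proof (cases "i < k")
      case True
      then have "contains_copy (colour_graph (complete_graph N) c i) H"
        using contains_copy_if_clique[OF H V sub(2) _ clique] sub(3) by (simp add: nth_append)
      then show ?thesis using True by blast
    next
      case False
      then have "i = k" using i by simp
      then show ?thesis
        using contains_copy_if_clique[OF G V sub(2) _ clique] sub(3) by (simp add: nth_append)
    qed
  qed
  then show ?thesis unfolding ramsey_arrow_def by blast
qed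

end

theory Submission
  imports Defs "HOL-Probability.Product_PMF"
begin

text \<open>
  Colours \<open>0\<close> and \<open>k\<close> suffice. Put \<open>L = ln (m t)\<close> and let colour \<open>0\<close> be a random graph \<open>G(n, p)\<close>
  with \<open>p = 16 L / m\<close> and \<open>n \<approx> d m\<^sup>2 t / L\<^sup>2\<close>, so that codegrees have mean \<open>n p\<^sup>2 \<le> 256 d t\<close>. The
  expected number of copies of \<open>K\<^sub>2\<^sub>,\<^sub>t\<close> is at most \<open>n\<^sup>2 (256 e d)\<^sup>t\<close>, which is small because
  \<open>m \<le> c2 2\<^sup>t\<close> makes \<open>n\<^sup>2\<close> at most exponential in \<open>t\<close>; the expected number of independent
  \<open>m\<close>-sets is small because \<open>p (m - 1) / 2 \<ge> 4 L\<close> exceeds \<open>ln n\<close>. If \<open>p > 1\<close>, then the bound is at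
  most \<open>256 d t\<close>, and a complete graph on \<open>t\<close> vertices in colour \<open>0\<close> already does better. The
  hypothesis \<open>c1 ln\<^sup>2 t \<le> m\<close> matters only for \<open>m = 1\<close>, where it bounds \<open>t\<close>.
\<close>

section \<open>From a good graph to a Ramsey lower bound\<close>

text \<open>Edges satisfying \<open>f\<close> get colour \<open>0\<close>, all others colour
  \<open>k\<close>, and \<open>k \<ge> 1\<close> keeps the two apart. As
  \<open>ramsey_number\<close> is a \<open>LEAST\<close>, the arrow relation is refuted for every
  \<open>r \<le> n\<close> by restricting this colouring to the first \<open>r\<close> vertices; no
  monotonicity in \<open>r\<close> has to be shown.\<close>

lemma ramsey_number_greater:
  fixes n k t m :: nat and f :: "nat set \<Rightarrow> bool"
  assumes k: "k \<ge> 1" and t: "t \<ge> 1"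
    and bip: "\<And>u v T. \<lbrakk>u < n; v < n; u \<noteq> v; T \<subseteq> {..<n}; u \<notin> T; v \<notin> T; card T = t\<rbrakk>
        \<Longrightarrow> \<exists>w\<in>T. \<not> (f {u, w} \<and> f {v, w})"
    and indep: "\<And>X. \<lbrakk>X \<subseteq> {..<n}; card X = m\<rbrakk> \<Longrightarrow> \<exists>e\<in>nsets X 2. f e"
  shows "n < ramsey_number k (complete_bipartite_graph 2 t) (complete_graph m)"
proof -
  have no_arrow: "\<not> ramsey_arrow r k (complete_bipartite_graph 2 t) (complete_graph m)" if "r \<le> n" for r
  proof
    define c where "c = (\<lambda>e. if f e then 0 else k)"
    assume "ramsey_arrow r k (complete_bipartite_graph 2 t) (complete_graph m)"
    moreover have "c \<in> edges (complete_graph r) \<rightarrow> {..k}" by (auto simp: c_def)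
    ultimately consider
      (bip) i where "i < k"
        "contains_copy (colour_graph (complete_graph r) c i) (complete_bipartite_graph 2 t)"
      | (clique) "contains_copy (colour_graph (complete_graph r) c k) (complete_graph m)"
      unfolding ramsey_arrow_def by blast
    then show False
    proof cases
      case (bip i)
      from bip(2) obtain \<phi> where inj: "inj_on \<phi> ({..<2 :: nat} <+> {..<t})"
        and ran: "\<phi> ` ({..<2} <+> {..<t}) \<subseteq> {..<r}"
        and edges: "\<forall>e\<in>{{Inl a, Inr b} | a b. a < 2 \<and> b < t}. c (\<phi> ` e) = i"
        by (auto simp: contains_copy_def colour_graph_def complete_graph_def
            complete_bipartite_graph_def)
      have edge: "c {\<phi> (Inl a), \<phi> (Inr b)} = i" if "a < 2" "b < t" for a b
        using edges[rule_format, of "{Inl a, Inr b}"] that by auto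
      let ?T = "(\<lambda>b. \<phi> (Inr b)) ` {..<t}"
      have f: "f {\<phi> (Inl a), w}" if "a < 2" "w \<in> ?T" for a w
      proof -
        from that(2) obtain b where "b < t" "w = \<phi> (Inr b)" by auto
        with edge[OF that(1)] bip(1) have "c {\<phi> (Inl a), w} < k" by simp
        then show ?thesis by (simp add: c_def split: if_splits)
      qed
      have bound: "\<phi> x < n" if "x \<in> {..<2} <+> {..<t}" for x
        using ran that \<open>r \<le> n\<close> by (meson image_subset_iff lessThan_iff less_le_trans)
      then have less: "\<phi> (Inl a) < n" if "a < 2" for a
        using that by (simp add: InlI)
      have "inj_on (\<lambda>b. \<phi> (Inr b)) {..<t}"
        using inj by (auto simp: inj_on_def)
      then have "card ?T = t" by (simp add: card_image)
      moreover have "?T \<subseteq> {..<n}"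
        using bound by (auto simp: InrI)
      moreover have notin: "\<phi> (Inl a) \<notin> ?T" if "a < 2" for a
        using inj that by (auto simp: inj_on_def)
      moreover have "\<phi> (Inl 0) \<noteq> \<phi> (Inl 1)"
        using inj_onD[OF inj, of "Inl 0" "Inl 1"] by (auto simp: InlI)
      ultimately show False
        using assms(3)[of "\<phi> (Inl 0)" "\<phi> (Inl 1)" ?T] less[of 0] less[of 1] f[of 0] f[of 1] by auto
    next
      case clique
      then obtain \<phi> where inj: "inj_on \<phi> {..<m}" and ran: "\<phi> ` {..<m} \<subseteq> {..<r}"
        and edge: "\<And>e. e \<in> nsets {..<m} 2 \<Longrightarrow> c (\<phi> ` e) = k"
        unfolding contains_copy_def colour_graph_def complete_graph_def by auto
      have "\<phi> ` {..<m} \<subseteq> {..<n}" using ran \<open>r \<le> n\<close> by fastforce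
      then obtain e where e: "e \<in> nsets (\<phi> ` {..<m}) 2" "f e"
        using indep[of "\<phi> ` {..<m}"] inj by (auto simp: card_image)
      obtain e' where e': "e' \<subseteq> {..<m}" "e = \<phi> ` e'"
        using e(1) by (auto simp: nsets_def subset_image_iff)
      have "card e' = 2"
        using e(1) card_image[OF inj_on_subset[OF inj e'(1)]] e'(2) by (simp add: nsets_def)
      with e'(1) have "e' \<in> nsets {..<m} 2"
        by (auto simp: nsets_def intro: finite_subset)
      from edge[OF this] e(2) e'(2) k show False
        by (auto simp: c_def)
    qed
  qed
  \<comment> \<open>A \<open>LEAST\<close> has its defining property only if some witness exists;
    Ramsey's theorem supplies one.\<close>
  obtain r where "ramsey_arrow r k (complete_bipartite_graph 2 t) (complete_graph m)"
    using ramsey_arrow_ex[OF simple_graph_complete_bipartite simple_graph_complete] by blast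
  then have "ramsey_arrow (ramsey_number k (complete_bipartite_graph 2 t) (complete_graph m)) k
      (complete_bipartite_graph 2 t) (complete_graph m)"
    unfolding ramsey_number_def by (rule LeastI)
  with no_arrow show ?thesis by (meson not_less)
qed

section \<open>First-moment bound in the random graph\<close>

text \<open>The event is a product set, so independence applies, and coordinates outside
  \<open>S\<close> contribute the factor 1. \<open>b = True\<close> serves copies of
  \<open>K\<^sub>2\<^sub>,\<^sub>t\<close>, \<open>b = False\<close> independent sets.\<close>

lemma prob_Pi_bernoulli_const:
  assumes "finite E" "S \<subseteq> E"
  shows "measure_pmf.prob (Pi_pmf E False (\<lambda>_. bernoulli_pmf p)) {f. \<forall>e\<in>S. f e = b} =
    pmf (bernoulli_pmf p) b ^ card S"
proof -
  have "{f. \<forall>e\<in>S. f e = b} = Pi E (\<lambda>e. if e \<in> S then {b} else UNIV)"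
    using assms(2) by (auto simp: Pi_iff split: if_splits)
  then have "measure_pmf.prob (Pi_pmf E False (\<lambda>_. bernoulli_pmf p)) {f. \<forall>e\<in>S. f e = b} =
      (\<Prod>e\<in>E. measure_pmf.prob (bernoulli_pmf p) (if e \<in> S then {b} else UNIV))"
    using assms(1) by (simp add: measure_Pi_pmf_Pi)
  also have "\<dots> = (\<Prod>e\<in>E. if e \<in> S then pmf (bernoulli_pmf p) b else 1)"
    by (intro prod.cong) (auto simp: measure_pmf_single)
  also have "\<dots> = pmf (bernoulli_pmf p) b ^ card S"
    using assms by (simp add: prod.If_cases Int_absorb1)
  finally show ?thesis .
qed

text \<open>An equality \<open>{u, w} = {v, w'}\<close> would force \<open>u = w'\<close>, hence
  \<open>u \<in> T\<close>. This gives the exact exponent \<open>2 * t\<close> in the probability of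
  a copy.\<close>

lemma card_star_pair:
  assumes "finite T" "u \<noteq> v" "u \<notin> T" "v \<notin> T"
  shows "card ((\<lambda>w. {u, w}) ` T \<union> (\<lambda>w. {v, w}) ` T) = 2 * card T"
proof -
  have "inj_on (\<lambda>w. {u, w}) T" "inj_on (\<lambda>w. {v, w}) T"
    by (auto simp: inj_on_def doubleton_eq_iff)
  moreover have "(\<lambda>w. {u, w}) ` T \<inter> (\<lambda>w. {v, w}) ` T = {}"
    using assms by (auto simp: doubleton_eq_iff)
  ultimately show ?thesis
    using assms(1) by (simp add: card_Un_disjoint card_image)
qed

text \<open>Union bound over the bad events. The factor \<open>n\<^sup>2\<close> counts ordered
  pairs \<open>(u, v)\<close>, so each copy is counted twice, which costs only a constant.\<close>

lemma ramsey_number_greater_random: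
  fixes n k t m :: nat and p :: real
  assumes k: "k \<ge> 1" and t: "t \<ge> 1" and p: "0 \<le> p" "p \<le> 1"
    and less: "(real n)\<^sup>2 * real (n choose t) * p ^ (2 * t)
      + real (n choose m) * (1 - p) ^ (m choose 2) < 1"
  shows "n < ramsey_number k (complete_bipartite_graph 2 t) (complete_graph m)"
proof -
  define E where "E = nsets {..<n} 2"
  define M where "M = Pi_pmf E False (\<lambda>_. bernoulli_pmf p)"
  define star where "star = (\<lambda>(u, v, T). (\<lambda>w. {u, w}) ` T \<union> (\<lambda>w. {v :: nat, w}) ` T)"
  define I where "I = {(u, v, T) \<in> {..<n} \<times> {..<n} \<times> nsets {..<n} t. u \<noteq> v \<and> u \<notin> T \<and> v \<notin> T}"
  define J where "J = nsets {..<n} m"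
  define A where "A = (\<lambda>x. {f :: nat set \<Rightarrow> bool. \<forall>e\<in>star x. f e = True})"
  define B where "B = (\<lambda>X :: nat set. {f :: nat set \<Rightarrow> bool. \<forall>e\<in>nsets X 2. f e = False})"
  have finE: "finite E" by (simp add: E_def finite_imp_finite_nsets)
  have I_sub: "I \<subseteq> {..<n} \<times> {..<n} \<times> nsets {..<n} t" by (auto simp: I_def)
  have fin: "finite ({..<n} \<times> {..<n} \<times> nsets {..<n} t)" by (simp add: finite_imp_finite_nsets)
  have finI: "finite I" using I_sub fin by (rule finite_subset)
  have "card I \<le> n * (n * (n choose t))"
    using card_mono[OF fin I_sub] by (simp add: card_cartesian_product)
  then have cardI: "real (card I) \<le> (real n)\<^sup>2 * real (n choose t)"
    by (simp add: power2_eq_square mult.assoc flip: of_nat_mult)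
  have finJ: "finite J" by (simp add: J_def finite_imp_finite_nsets)
  have A: "measure_pmf.prob M (A x) = p ^ (2 * t)" if "x \<in> I" for x
  proof -
    obtain u v T where x: "x = (u, v, T)" by (cases x)
    have T: "u < n" "v < n" "u \<noteq> v" "u \<notin> T" "v \<notin> T" "T \<subseteq> {..<n}" "finite T" "card T = t"
      using that by (auto simp: x I_def nsets_def)
    have "star x \<subseteq> E"
      using T by (auto simp: x star_def E_def nsets_def card_2_iff)
    moreover have "card (star x) = 2 * t"
      using T card_star_pair[of T u v] by (simp add: x star_def)
    ultimately show ?thesis
      unfolding M_def A_def using prob_Pi_bernoulli_const[OF finE, of "star x" p True] p by simp
  qed
  have B: "measure_pmf.prob M (B X) = (1 - p) ^ (m choose 2)" if "X \<in> J" for X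
  proof -
    have X: "X \<subseteq> {..<n}" "card X = m" using that by (auto simp: J_def nsets_def)
    have "nsets X 2 \<subseteq> E" using X by (simp add: E_def nsets_mono)
    moreover have "card (nsets X 2) = m choose 2" using X by simp
    ultimately show ?thesis
      unfolding M_def B_def using prob_Pi_bernoulli_const[OF finE, of "nsets X 2" p False] p by simp
  qed
  have "measure_pmf.prob M ((\<Union>x\<in>I. A x) \<union> (\<Union>X\<in>J. B X)) \<le>
      measure_pmf.prob M (\<Union>x\<in>I. A x) + measure_pmf.prob M (\<Union>X\<in>J. B X)"
    by (rule measure_Un_le) auto
  also have "\<dots> \<le> (\<Sum>x\<in>I. measure_pmf.prob M (A x)) + (\<Sum>X\<in>J. measure_pmf.prob M (B X))"
    using finI finJ by (intro add_mono measure_pmf.finite_measure_subadditive_finite) auto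
  also have "\<dots> = real (card I) * p ^ (2 * t) + real (n choose m) * (1 - p) ^ (m choose 2)"
    using A B by (simp add: J_def)
  also have "\<dots> < 1"
    using less mult_right_mono[OF cardI, of "p ^ (2 * t)"] p by simp
  finally have "(\<Union>x\<in>I. A x) \<union> (\<Union>X\<in>J. B X) \<noteq> UNIV" by auto
  then obtain f where fA: "\<And>x. x \<in> I \<Longrightarrow> f \<notin> A x" and fB: "\<And>X. X \<in> J \<Longrightarrow> f \<notin> B X"
    by blast
  show ?thesis
  proof (rule ramsey_number_greater[OF k t, where f = f])
    fix u v T
    assume "u < n" "v < n" "u \<noteq> v" "T \<subseteq> {..<n}" "u \<notin> T" "v \<notin> T" "card T = t"
    then have "(u, v, T) \<in> I" by (auto simp: I_def nsets_def intro: finite_subset)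
    from fA[OF this] show "\<exists>w\<in>T. \<not> (f {u, w} \<and> f {v, w})"
      by (auto simp: A_def star_def)
  next
    fix X assume "X \<subseteq> {..<n}" "card X = m"
    then have "X \<in> J" by (auto simp: J_def nsets_def intro: finite_subset)
    from fB[OF this] show "\<exists>e\<in>nsets X 2. f e" by (auto simp: B_def)
  qed
qed

section \<open>Estimates for the two expectations\<close>

text \<open>The quotient of \<open>t ^ t\<close> by \<open>fact t\<close> is a single term of the
  exponential series at \<open>t\<close>.\<close>

lemma power_self_le_fact_exp: "real t ^ t \<le> fact t * exp (real t)"
proof -
  have "(\<Sum>i\<in>{t}. inverse (fact i) * real t ^ i) \<le> (\<Sum>i. inverse (fact i) * real t ^ i)"
    by (intro sum_le_suminf summable_exp) auto
  then have "real t ^ t / fact t \<le> exp (real t)"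
    by (simp add: exp_def scaleR_conv_of_real field_simps)
  then show ?thesis by (simp add: field_simps)
qed

text \<open>Combines \<open>n choose t \<le> n ^ t / fact t\<close> with the previous bound. It is
  applied with \<open>q = p\<^sup>2\<close>, where \<open>n * q\<close> approximates the mean
  codegree.\<close>

lemma binomial_mult_power_le:
  fixes q \<delta> :: real
  assumes q: "q \<ge> 0" and le: "real n * q \<le> \<delta> * real t"
  shows "real (n choose t) * q ^ t \<le> (\<delta> * exp 1) ^ t"
proof -
  have "fact t * (n choose t) \<le> n ^ t"
    using binomial_fact_pow[of n t] by (simp add: mult.commute)
  then have "real (fact t * (n choose t)) \<le> real (n ^ t)" by (simp only: of_nat_le_iff)
  then have "fact t * real (n choose t) * q ^ t \<le> real n ^ t * q ^ t"
    using q by (intro mult_right_mono) auto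
  also have "\<dots> \<le> (\<delta> * real t) ^ t"
    using q le by (simp flip: power_mult_distrib add: power_mono)
  also have "\<dots> = \<delta> ^ t * real t ^ t" by (simp add: power_mult_distrib)
  also have "\<dots> \<le> \<delta> ^ t * (fact t * exp (real t))"
  \<comment> \<open>The hypothesis forces \<open>\<delta> \<ge> 0\<close> only for positive
    \<open>t\<close>.\<close>
  proof (cases "t = 0")
    case False
    have "0 \<le> real n * q" using q by simp
    with le False have "\<delta> \<ge> 0"
      by (metis dual_order.trans of_nat_0_less_iff zero_le_mult_iff not_gr_zero order.asym leD)
    then show ?thesis by (intro mult_left_mono power_self_le_fact_exp) auto
  qed simp
  also have "\<dots> = fact t * (\<delta> * exp 1) ^ t"
    by (simp add: power_mult_distrib flip: exp_of_nat_mult)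
  finally show ?thesis by (simp add: mult.assoc)
qed

text \<open>Uses \<open>n choose m \<le> n ^ m\<close> and \<open>1 - p \<le> exp (- p)\<close>;
  since \<open>m choose 2 = m * (m - 1) / 2\<close>, the product is an \<open>m\<close>-th
  power.\<close>

lemma binomial_mult_exp_le:
  fixes p :: real
  assumes p: "0 \<le> p" "p \<le> 1"
  shows "real (n choose m) * (1 - p) ^ (m choose 2) \<le> (real n * exp (- p * (real m - 1) / 2)) ^ m"
proof -
  have "real (m choose 2) = real m * (real m - 1) / 2"
  proof -
    have "even (m * (m - 1))" by (cases m) auto
    then show ?thesis by (cases m) (auto simp: choose_two real_of_nat_div algebra_simps)
  qed
  note choose = this
  have "n choose m \<le> n ^ m" 
    by (metis binomial_eq_0 binomial_le_pow le0 not_le)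
  then have 1: "real (n choose m) \<le> real n ^ m" by (metis of_nat_le_iff of_nat_power)
  have "(1 - p) ^ (m choose 2) \<le> exp (- p) ^ (m choose 2)"
    using p exp_ge_add_one_self[of "- p"] by (intro power_mono) auto
  also have "\<dots> = exp (- p * (real m - 1) / 2) ^ m"
    by (simp add: choose flip: exp_of_nat_mult)
  finally have "real (n choose m) * (1 - p) ^ (m choose 2)
      \<le> real n ^ m * exp (- p * (real m - 1) / 2) ^ m"
    using 1 p by (intro mult_mono) auto
  then show ?thesis by (simp add: power_mult_distrib)
qed

section \<open>Choice of parameters\<close>

lemma ramsey_number_lower_bound:
  fixes k t m :: nat and c d :: real
  defines "L \<equiv> ln (real m * real t)"
  assumes k: "k \<ge> 1" and t: "t \<ge> 2" and m: "m \<ge> 2"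
    and c: "0 < c" "real m \<le> c * 2 ^ t"
    and d: "0 < d" "d \<le> 1 / 2 ^ 17" "d * c\<^sup>2 \<le> 1"
    and mL: "16 * L \<le> real m"
  shows "d * ((real m)\<^sup>2 * real t / L\<^sup>2)
    \<le> real (ramsey_number k (complete_bipartite_graph 2 t) (complete_graph m))"
proof -
  have "real m * real t \<ge> 2 * 2" using m t by (intro mult_mono) auto
  then have mt: "real m * real t \<ge> 4" by simp
  have "exp 1 \<le> real m * real t" using exp_le mt by linarith
  then have L: "L \<ge> 1" using mt unfolding L_def by (subst ln_ge_iff) linarith+
  then have L2: "L\<^sup>2 \<ge> 1" by (simp add: one_le_power)
  define x where "x = d * ((real m)\<^sup>2 * real t / L\<^sup>2)"
  define n where "n = nat \<lfloor>x\<rfloor>"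
  define p where "p = 16 * L / real m"
  have x0: "x \<ge> 0" using d by (simp add: x_def)
  have nx: "real n \<le> x" using x0 by (simp add: n_def)
  have p: "0 \<le> p" "p \<le> 1" using L mL m by (auto simp: p_def)
  have "x \<le> d * ((real m)\<^sup>2 * real t / 1)"
    unfolding x_def using d L2 by (intro mult_left_mono divide_left_mono) auto
  then have n: "real n \<le> d * (real m)\<^sup>2 * real t" using nx by simp

  have "real n * p\<^sup>2 \<le> x * p\<^sup>2" using nx by (intro mult_right_mono) auto
  also have "\<dots> = 256 * d * real t"
    using L m by (simp add: x_def p_def power_divide power_mult_distrib)
  finally have "real (n choose t) * (p\<^sup>2) ^ t \<le> (256 * d * exp 1) ^ t"
    by (intro binomial_mult_power_le) auto
  \<comment> \<open>The bound \<open>1 / 2 ^ 17\<close> on \<open>d\<close> makes the base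
    \<open>3 / 512\<close>, small enough to absorb the factor \<open>64 ^ t\<close> coming from
    \<open>n\<^sup>2\<close>.\<close>
  also have "\<dots> \<le> (256 * (1 / 2 ^ 17) * 3) ^ t"
    using d exp_le by (intro power_mono mult_mono) auto
  finally have b1: "real (n choose t) * p ^ (2 * t) \<le> (3 / 512) ^ t"
    by (simp add: power_mult)
  \<comment> \<open>Here the upper bound on \<open>m\<close> enters: with
    \<open>d * c\<^sup>2 \<le> 1\<close> and \<open>t \<le> 2 ^ t\<close> it yields
    \<open>n \<le> 8 ^ t\<close>.\<close>
  have "(real m)\<^sup>2 \<le> (c * 2 ^ t)\<^sup>2" using c by (intro power_mono) auto
  then have "real n \<le> d * (c * 2 ^ t)\<^sup>2 * real t"
    using n d by (meson mult_left_mono mult_right_mono of_nat_0_le_iff order_trans less_imp_le)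
  also have "\<dots> = d * c\<^sup>2 * (4 ^ t * real t)"
    by (simp add: power_mult_distrib power2_eq_square flip: power_mult_distrib)
  also have "\<dots> \<le> 1 * (4 ^ t * 2 ^ t)"
    using d c by (intro mult_mono) (auto intro: less_imp_le of_nat_less_two_power)
  finally have "real n \<le> 8 ^ t" by (simp flip: power_mult_distrib)
  then have "(real n)\<^sup>2 \<le> (8 ^ t)\<^sup>2" by (intro power_mono) auto
  also have "\<dots> = 64 ^ t" by (simp add: power2_eq_square flip: power_mult_distrib)
  finally have "(real n)\<^sup>2 * (real (n choose t) * p ^ (2 * t)) \<le> 64 ^ t * (3 / 512) ^ t"
    using b1 p by (intro mult_mono) auto
  also have "\<dots> = (3 / 8) ^ t" by (simp flip: power_mult_distrib)
  also have "\<dots> \<le> (3 / 8) ^ 2" using t by (intro power_decreasing) auto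
  finally have K: "(real n)\<^sup>2 * real (n choose t) * p ^ (2 * t) \<le> 9 / 64"
    by (simp add: power2_eq_square mult.assoc)

  \<comment> \<open>Since \<open>m \<ge> 2\<close>, \<open>m - 1 \<ge> m / 2\<close>. The resulting
    decay \<open>(m * t) ^ (-4)\<close> beats \<open>n \<le> (m * t)\<^sup>2\<close>.\<close>
  have "p * (real m - 1) / 2 \<ge> p * (real m / 2) / 2"
    using p m by (intro divide_right_mono mult_left_mono) auto
  moreover have "p * (real m / 2) / 2 = 4 * L" using m by (simp add: p_def)
  ultimately have "exp (- p * (real m - 1) / 2) \<le> exp (- (4 * L))" by simp
  also have "\<dots> = 1 / (real m * real t) ^ 4"
    using mt exp_of_nat_mult[of 4 L] by (simp add: L_def exp_minus inverse_eq_divide)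
  finally have e: "exp (- p * (real m - 1) / 2) \<le> 1 / (real m * real t) ^ 4" .
  have "d * (real m)\<^sup>2 * real t \<le> 1 * (real m)\<^sup>2 * (real t)\<^sup>2"
    using d t by (intro mult_mono) (auto simp: power2_eq_square)
  then have "real n \<le> (real m * real t)\<^sup>2" using n by (simp add: power_mult_distrib)
  then have "real n * exp (- p * (real m - 1) / 2)
      \<le> (real m * real t)\<^sup>2 * (1 / (real m * real t) ^ 4)"
    using e by (intro mult_mono) auto
  also have "\<dots> = 1 / (real m * real t)\<^sup>2"
    using mt by (simp add: power2_eq_square power4_eq_xxxx)
  also have "\<dots> \<le> 1 / 4\<^sup>2" using m t mt by (intro divide_left_mono power_mono mult_pos_pos) auto
  finally have q: "real n * exp (- p * (real m - 1) / 2) \<le> 1 / 16" by simp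
  have "real (n choose m) * (1 - p) ^ (m choose 2) \<le> (real n * exp (- p * (real m - 1) / 2)) ^ m"
    using p by (rule binomial_mult_exp_le)
  also have "\<dots> \<le> (1 / 16) ^ m" using q by (intro power_mono) auto
  also have "\<dots> \<le> (1 / 16) ^ 1" using m by (intro power_decreasing) auto
  finally have "real (n choose m) * (1 - p) ^ (m choose 2) \<le> 1 / 16" by simp
  with K have "(real n)\<^sup>2 * real (n choose t) * p ^ (2 * t)
      + real (n choose m) * (1 - p) ^ (m choose 2) < 1" by linarith
  then have "n < ramsey_number k (complete_bipartite_graph 2 t) (complete_graph m)"
    using k t p by (intro ramsey_number_greater_random[of k t p]) auto
  \<comment> \<open>Rounding down loses nothing: the Ramsey number is at least \<open>n + 1\<close>,
    which exceeds \<open>x\<close>.\<close>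
  moreover have "x < real n + 1" using x0 unfolding n_def by linarith
  ultimately show ?thesis unfolding x_def by linarith
qed

section \<open>Assembling the ranges of \<open>m\<close>\<close>

theorem proposition3:
  fixes k :: nat and c1 c2 :: real
  assumes "k \<ge> 1" and "c1 > 0" and "c2 > 0"
  shows "\<exists>d::real. d > 0 \<and>
    (\<forall>t m :: nat. t \<ge> 2 \<and> c1 * (ln (real t))\<^sup>2 \<le> real m \<and> real m \<le> c2 * 2 ^ t \<longrightarrow>
      real (ramsey_number k (complete_bipartite_graph 2 t) (complete_graph m))
        \<ge> d * ((real m)\<^sup>2 * real t / (ln (real m * real t))\<^sup>2))"
proof -
  \<comment> \<open>The first term serves the random construction and the case \<open>p > 1\<close>,
    the second gives \<open>d * c2\<^sup>2 \<le> 1\<close>, the third handles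
    \<open>m = 1\<close>.\<close>
  define d :: real where
    "d = min (min (1 / 2 ^ 17) (1 / c2\<^sup>2)) ((ln 2)\<^sup>2 * exp (- (1 / sqrt c1)))"
  have d: "d > 0" "d \<le> 1 / 2 ^ 17" "d \<le> 1 / c2\<^sup>2" "d \<le> (ln 2)\<^sup>2 * exp (- (1 / sqrt c1))"
    using assms by (auto simp: d_def)
  have dc: "d * c2\<^sup>2 \<le> 1" using d(3) assms(3) by (simp add: field_simps)
  have "d * ((real m)\<^sup>2 * real t / (ln (real m * real t))\<^sup>2)
      \<le> real (ramsey_number k (complete_bipartite_graph 2 t) (complete_graph m))"
    (is "?lhs \<le> real ?r")
    if t: "t \<ge> 2" and c1: "c1 * (ln (real t))\<^sup>2 \<le> real m" and c2: "real m \<le> c2 * 2 ^ t"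
    for t m :: nat
  proof -
    consider "m = 0" | "m = 1" | "m \<ge> 2" "real m < 16 * ln (real m * real t)"
      | "m \<ge> 2" "16 * ln (real m * real t) \<le> real m" by linarith
    then show ?thesis
    proof cases
      case 1
      then show ?thesis by simp
    next
      case 2
      \<comment> \<open>For \<open>m = 1\<close> the left side is
        \<open>d * t / (ln t)\<^sup>2\<close>; the lower bound on \<open>m\<close> bounds
        \<open>t\<close> above, and \<open>ln t \<ge> ln 2\<close>, so it is at most 1.\<close>
      have "(ln (real t))\<^sup>2 \<le> 1 / c1" using c1 2 assms(2) by (simp add: field_simps)
      then have "ln (real t) \<le> 1 / sqrt c1"
        using real_le_rsqrt[of "ln (real t)" "1 / c1"] by (simp add: real_sqrt_divide)
      then have t_le: "real t \<le> exp (1 / sqrt c1)"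
        using t by (metis exp_le_cancel_iff exp_ln of_nat_0_less_iff order_less_le_trans zero_less_numeral)
      have "d * real t \<le> (ln 2)\<^sup>2 * exp (- (1 / sqrt c1)) * exp (1 / sqrt c1)"
        using d(1,4) t_le by (intro mult_mono) auto
      also have "\<dots> = (ln 2)\<^sup>2" by (simp add: mult.assoc flip: exp_add)
      also have "\<dots> \<le> (ln (real t))\<^sup>2" using t by (intro power_mono) auto
      finally have "?lhs \<le> 1" using 2 t by (simp add: divide_simps)
      \<comment> \<open>Taken with \<open>n = 0\<close>, where both conditions are vacuous.\<close>
      moreover have "0 < ?r"
        using 2 t assms(1) by (intro ramsey_number_greater[where f = "\<lambda>_. True"]) auto
      ultimately show ?thesis by linarith
    next
      case 3
      let ?L = "ln (real m * real t)"
      have "?L > 0" using 3 by linarith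
      have "(real m)\<^sup>2 \<le> (16 * ?L)\<^sup>2" using 3 by (intro power_mono) auto
      then have "(real m)\<^sup>2 / ?L\<^sup>2 \<le> 256"
        using \<open>?L > 0\<close> by (simp add: divide_simps power_mult_distrib)
      then have "d * ((real m)\<^sup>2 / ?L\<^sup>2) * real t \<le> (1 / 2 ^ 17) * 256 * real t"
        using d by (intro mult_mono) auto
      also have "\<dots> \<le> real t" by simp
      finally have "?lhs \<le> real t" by (simp add: mult.assoc)
      \<comment> \<open>On \<open>t\<close> vertices a \<open>t\<close>-set \<open>T\<close> is the
        whole vertex set and cannot avoid \<open>u\<close>, so the complete graph has no
        \<open>K\<^sub>2\<^sub>,\<^sub>t\<close>.\<close>
      moreover have "t < ?r"
      proof (rule ramsey_number_greater[where f = "\<lambda>_. True"])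
        fix u v T assume T: "u < t" "u \<notin> T" "T \<subseteq> {..<t}" "card T = t"
        then have "T = {..<t}" by (intro card_subset_eq) auto
        with T show "\<exists>w\<in>T. \<not> (True \<and> True)" by auto
      next
        fix X :: "nat set" assume "card X = m"
        then obtain Y where "Y \<subseteq> X" "card Y = 2"
          using obtain_subset_with_card_n[of 2 X] 3 by auto
        then show "\<exists>e\<in>nsets X 2. True"
          by (auto simp: nsets_def intro!: exI[of _ Y] card_ge_0_finite)
      qed (use assms(1) t in auto)
      ultimately show ?thesis by linarith
    next
      case 4
      then show ?thesis using assms t c2 d dc by (intro ramsey_number_lower_bound) auto
    qed
  qed
  with d(1) show ?thesis by blast
qed

end
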